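(* Let $\mathbf{R}$ be a discrete coherent commutative ring with unit, let $n,m\ge 1$, let $\mathbf{R}[\underline{X}]=\mathbf{R}[X_1,\dots,X_n]$, and let $>$ be a monomial order on the free module $\mathbf{H}_n^m=\mathbf{R}[\underline{X}]^m$. Let $f_1,\dots,f_p\in\mathbf{H}_n^m\setminus\{0\}$ ($p\ge 1$). For any $u\in\langle f_1,\dots,f_p\rangle$ there exist $q\in\mathbb{N}$ and items $p_1,\dots,p_t$ in the iterated S-list $\mathscr{S}^{q}(f_1,\dots,f_p)$ such that $\operatorname{LT}(u)\in\langle \operatorname{LT}(p_1),\dots,\operatorname{LT}(p_t)\rangle$. In other words, \[\operatorname{MLT}(\langle f_1,\dots,f_p\rangle)=\bigcup_{q\in\mathbb{N}}\langle \operatorname{LT}(\mathscr{S}^q(f_1,\dots,f_p))\rangle,\] the union being increasing in $q$.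
   Context: **Rings.** A ring $\mathbf{R}$ is discrete if equality in it is decidable (zero test). For elements $v_1,\dots,v_k$ of an $A$-module ($A$ a commutative ring), $\operatorname{Syz}(v_1,\dots,v_k)=\{(b_1,\dots,b_k)\in A^k : b_1v_1+\dots+b_kv_k=0\}$. $\mathbf{R}$ is coherent if for every finite family of elements of $\mathbf{R}$ the syzygy module is finitely generated (constructively: with an algorithm computing generators, and an algorithm writing each syzygy as a combination of them). We fix a certificate of coherence, i.e. a choice, for every finite family $(a_j)_{j\in E}$ in $\mathbf{R}$, of a finite list of generators of $\operatorname{Syz}((a_j)_{j\in E})$. $\langle\cdots\rangle$ denotes the $\mathbf{R}[\underline{X}]$-submodule generated. **Monomials.** $(e_1,\dots,e_m)$ is the canonical basis of $\mathbf{H}_n^m$. A monomial of $\mathbf{H}_n^m$ is a vector $\underline{X}^\alpha e_i$; $i$ is its position. $\underline{X}^\alpha e_i$ divides $\underline{X}^\beta e_j$ if $i=j$ and $\underline{X}^\alpha$ divides $\underline{X}^\beta$; the quotient is then $\underline{X}^{\beta-\alpha}\in\mathbf{R}[\underline{X}]$. The lcm of monomials with the same position $i$ is the lcm of their $\underline{X}$-parts times $e_i$. A monomial order on $\mathbf{H}_n^m$ is a total order $>$ on its monomials such that $\underline{X}^\alpha M>M$ for all monomials $M$ and $\underline{X}^\alpha\ne1$, and $M>N\Rightarrow \underline{X}^\alpha M>\underline{X}^\alpha N$. A nonzero $u\in\mathbf{H}_n^m$ is uniquely $c_tM_t+\dots+c_1M_1$ with $c_i\in\mathbf{R}\setminus\{0\}$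 and monomials $M_t>\dots>M_1$; $\operatorname{LC}(u)=c_t$, $\operatorname{LM}(u)=M_t$, $\operatorname{LT}(u)=c_tM_t$. Also $\operatorname{LC}(0)=0$, $\operatorname{LM}(0)=0$, $\operatorname{LT}(0)=0$. For a list $G$ of vectors, $\operatorname{LT}(G)$ is the list of the leading terms of its items. For a submodule $U$, $\operatorname{MLT}(U)=\langle \operatorname{LT}(u) : u\in U\rangle$. **Syzygies of terms.** Let $M_1,\dots,M_p$ be monomials of $\mathbf{H}_n^m$ and $a_1,\dots,a_p\in\mathbf{R}$. A position level set of $(M_1,\dots,M_p)$ is a nonempty $E\subseteq\{1,\dots,p\}$ such that all $M_j$, $j\in E$, have the same position. For such $E$ let $s^E_1,\dots,s^E_{\ell^E}$, with $s^E_i=(s^E_{i,j})_{j\in E}$, be the list of generators of $\operatorname{Syz}((a_j)_{j\in E})\subseteq\mathbf{R}^E$ given by the certificate of coherence; let $M^E=\operatorname{lcm}(M_j: j\in E)$ and $S^E_i=(S^E_{i,1},\dots,S^E_{i,p})\in\mathbf{R}[\underline{X}]^p$ with $S^E_{i,j}=s^E_{i,j}\,M^E/M_j$ if $j\in E$ and $S^E_{i,j}=0$ otherwise. $S(a_1M_1,\dots,a_pM_p)$ is the concatenation, over all position level sets $E$ of $(M_1,\dots,M_p)$, of the lists $S^E_1,\dots,S^E_{\ell^E}$. **S-lists.** For $f_1,\dots,f_p\in\mathbf{H}_n^m\setminus\{0\}$, let $S_1,\dots,S_\ell$ be the list $S(\operatorname{LT}(f_1),\dots,\operatorname{LT}(f_p))$,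 where $\operatorname{LT}(f_j)=a_jM_j$ with $a_j=\operatorname{LC}(f_j)$, $M_j=\operatorname{LM}(f_j)$. The S-list $\mathscr{S}(f_1,\dots,f_p)$ is the list of the vectors $S_{i,1}f_1+\dots+S_{i,p}f_p$, $i=1,\dots,\ell$, after deletion of the vanishing ones. The iterated S-lists are: $\mathscr{S}^0(f_1,\dots,f_p)=f_1,\dots,f_p$, and $\mathscr{S}^{q+1}(f_1,\dots,f_p)$ is the concatenation of $\mathscr{S}^q(f_1,\dots,f_p)$ with $\mathscr{S}(\mathscr{S}^q(f_1,\dots,f_p))$. *)

theory Defs
  imports "HOL-Analysis.Finite_Cartesian_Product" "HOL-Library.Poly_Mapping"
begin

(* R[X_1,...,X_n], with variables indexed by the finite type 'n, is the convolution ring of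
   finitely supported functions on exponent vectors. *)
type_synonym 'n expo = "'n \<Rightarrow>\<^sub>0 nat"
type_synonym ('n, 'a) polyring = "'n expo \<Rightarrow>\<^sub>0 'a"
type_synonym ('n, 'm, 'a) freemod = "('n, 'a) polyring ^ 'm"

(* The pair (alpha, i) stands for the monomial X^alpha e_i; see monom_vec. *)
type_synonym ('n, 'm) monom = "'n expo \<times> 'm"


section \<open>The free module\<close>

global_interpretation freemod: module "(*s) :: 'b::comm_ring_1 \<Rightarrow> 'b ^ 'm \<Rightarrow> 'b ^ 'm"
  by unfold_locales (simp_all add: vec_eq_iff algebra_simps)

definition monom_vec :: "('n, 'm) monom \<Rightarrow> ('n, 'm::finite, 'a::comm_ring_1) freemod" where
  "monom_vec M = axis (snd M) (Poly_Mapping.single (fst M) 1)"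

definition const_poly :: "'a::comm_ring_1 \<Rightarrow> ('n, 'a) polyring" where
  "const_poly c = Poly_Mapping.single 0 c"

definition coefficient ::
  "('n, 'm::finite, 'a::comm_ring_1) freemod \<Rightarrow> ('n, 'm) monom \<Rightarrow> 'a" where
  "coefficient u M = Poly_Mapping.lookup (u $ snd M) (fst M)"

definition support :: "('n, 'm::finite, 'a::comm_ring_1) freemod \<Rightarrow> ('n, 'm) monom set" where
  "support u = {M. coefficient u M \<noteq> 0}"

lemma finite_support: "finite (support u)"
proof -
  have "support u \<subseteq> (\<Union>i\<in>UNIV. (\<lambda>a. (a, i)) ` Poly_Mapping.keys (u $ i))"
    by (auto simp: support_def coefficient_def in_keys_iff image_iff)
  then show ?thesis
    by (rule finite_subset) auto
qed


section \<open>Monomials and monomial orders\<close>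

definition shift :: "'n expo \<Rightarrow> ('n, 'm) monom \<Rightarrow> ('n, 'm) monom" where
  "shift \<alpha> M = (\<alpha> + fst M, snd M)"

lemma monom_vec_shift: "monom_vec (shift \<alpha> M) = Poly_Mapping.single \<alpha> 1 *s monom_vec M"
  by (simp add: monom_vec_def shift_def vec_eq_iff axis_def mult_single)

(* gt M N reads M > N. *)
definition monomial_order :: "(('n, 'm) monom \<Rightarrow> ('n, 'm) monom \<Rightarrow> bool) \<Rightarrow> bool" where
  "monomial_order gt \<longleftrightarrow>
     irreflp gt \<and> transp gt \<and> totalp gt \<and>
     (\<forall>\<alpha> M. \<alpha> \<noteq> 0 \<longrightarrow> gt (shift \<alpha> M) M) \<and>
     (\<forall>\<alpha> M N. gt M N \<longrightarrow> gt (shift \<alpha> M) (shift \<alpha> N))"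

(* Only meaningful if N divides M. *)
definition monom_quot :: "('n, 'm) monom \<Rightarrow> ('n, 'm) monom \<Rightarrow> 'n expo" where
  "monom_quot M N = fst M - fst N"

(* lcm of the monomials Ms ! j, j in E, for a nonempty E on which the position is constant *)
definition monom_lcm :: "('n::finite, 'm) monom list \<Rightarrow> nat set \<Rightarrow> ('n, 'm) monom" where
  "monom_lcm Ms E =
     (Abs_poly_mapping (\<lambda>k. MAX j\<in>E. Poly_Mapping.lookup (fst (Ms ! j)) k),
      THE i. \<forall>j\<in>E. snd (Ms ! j) = i)"

lemma lookup_monom_lcm:
  "Poly_Mapping.lookup (fst (monom_lcm Ms E)) k = (MAX j\<in>E. Poly_Mapping.lookup (fst (Ms ! j)) k)"
  by (simp add: monom_lcm_def Abs_poly_mapping_inverse)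


section \<open>Leading terms\<close>

definition lead_monom ::
  "(('n, 'm) monom \<Rightarrow> ('n, 'm) monom \<Rightarrow> bool) \<Rightarrow> ('n, 'm::finite, 'a::comm_ring_1) freemod
     \<Rightarrow> ('n, 'm) monom" where
  "lead_monom gt u = (THE M. M \<in> support u \<and> (\<forall>N\<in>support u. N \<noteq> M \<longrightarrow> gt M N))"

definition LC ::
  "(('n, 'm) monom \<Rightarrow> ('n, 'm) monom \<Rightarrow> bool) \<Rightarrow> ('n, 'm::finite, 'a::comm_ring_1) freemod
     \<Rightarrow> 'a" where
  "LC gt u = (if u = 0 then 0 else coefficient u (lead_monom gt u))"

definition LM ::
  "(('n, 'm) monom \<Rightarrow> ('n, 'm) monom \<Rightarrow> bool) \<Rightarrow> ('n, 'm::finite, 'a::comm_ring_1) freemod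
     \<Rightarrow> ('n, 'm, 'a) freemod" where
  "LM gt u = (if u = 0 then 0 else monom_vec (lead_monom gt u))"

definition LT ::
  "(('n, 'm) monom \<Rightarrow> ('n, 'm) monom \<Rightarrow> bool) \<Rightarrow> ('n, 'm::finite, 'a::comm_ring_1) freemod
     \<Rightarrow> ('n, 'm, 'a) freemod" where
  "LT gt u = const_poly (LC gt u) *s LM gt u"

definition MLT ::
  "(('n, 'm) monom \<Rightarrow> ('n, 'm) monom \<Rightarrow> bool) \<Rightarrow> ('n, 'm::finite, 'a::comm_ring_1) freemod set
     \<Rightarrow> ('n, 'm, 'a) freemod set" where
  "MLT gt U = freemod.span {LT gt u | u. u \<in> U}"


section \<open>Coherence\<close>

(* A family indexed by E is a function on nat of which only the restriction to E matters;
   elements of R^E are represented by extensional functions. *)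
definition Syz :: "nat set \<Rightarrow> (nat \<Rightarrow> 'a::comm_ring_1) \<Rightarrow> (nat \<Rightarrow> 'a) set" where
  "Syz E a = {b \<in> extensional E. (\<Sum>j\<in>E. b j * a j) = 0}"

definition generates_Syz ::
  "nat set \<Rightarrow> (nat \<Rightarrow> 'a::comm_ring_1) \<Rightarrow> (nat \<Rightarrow> 'a) list \<Rightarrow> bool" where
  "generates_Syz E a L \<longleftrightarrow>
     set L \<subseteq> Syz E a \<and>
     (\<forall>b\<in>Syz E a. \<exists>c. \<forall>j\<in>E. b j = (\<Sum>i<length L. c i * (L ! i) j))"

definition coherent :: "'a::comm_ring_1 itself \<Rightarrow> bool" where
  "coherent _ \<longleftrightarrow>
     (\<forall>E (a :: nat \<Rightarrow> 'a). finite E \<and> a \<in> extensional E \<longrightarrow> (\<exists>L. generates_Syz E a L))"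

definition coherence_certificate ::
  "(nat set \<Rightarrow> (nat \<Rightarrow> 'a::comm_ring_1) \<Rightarrow> (nat \<Rightarrow> 'a) list) \<Rightarrow> bool" where
  "coherence_certificate cert \<longleftrightarrow>
     (\<forall>E a. finite E \<and> a \<in> extensional E \<longrightarrow> generates_Syz E a (cert E a))"

lemma coherent_iff_certificate:
  "coherent TYPE('a::comm_ring_1) \<longleftrightarrow>
     (\<exists>cert :: nat set \<Rightarrow> (nat \<Rightarrow> 'a) \<Rightarrow> (nat \<Rightarrow> 'a) list. coherence_certificate cert)"
  unfolding coherent_def coherence_certificate_def by metis


section \<open>Syzygies of terms\<close>

definition position_level_set :: "('n, 'm) monom list \<Rightarrow> nat set \<Rightarrow> bool" where
  "position_level_set Ms E \<longleftrightarrow>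
     E \<noteq> {} \<and> E \<subseteq> {..<length Ms} \<and> (\<forall>j\<in>E. \<forall>k\<in>E. snd (Ms ! j) = snd (Ms ! k))"

(* The order in which the lists belonging to the position level sets are concatenated is
   not canonical, so it is a parameter. *)
definition level_set_enumeration :: "(('n, 'm) monom list \<Rightarrow> nat set list) \<Rightarrow> bool" where
  "level_set_enumeration lev \<longleftrightarrow>
     (\<forall>Ms. distinct (lev Ms) \<and> set (lev Ms) = {E. position_level_set Ms E})"

lemma level_set_enumeration_exists:
  "\<exists>lev :: ('n, 'm) monom list \<Rightarrow> nat set list. level_set_enumeration lev"
proof -
  have "finite {E. position_level_set Ms E}" for Ms :: "('n, 'm) monom list"
    by (rule finite_subset[of _ "Pow {..<length Ms}"]) (auto simp: position_level_set_def)
  then have "\<forall>Ms :: ('n, 'm) monom list.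
      \<exists>Es. distinct Es \<and> set Es = {E. position_level_set Ms E}"
    using finite_distinct_list by metis
  then show ?thesis
    unfolding level_set_enumeration_def by metis
qed

(* The list S(a_1 M_1, ..., a_p M_p); only the components j < p of its items matter. *)
definition term_syzygies ::
  "(nat set \<Rightarrow> (nat \<Rightarrow> 'a::comm_ring_1) \<Rightarrow> (nat \<Rightarrow> 'a) list)
     \<Rightarrow> (('n::finite, 'm) monom list \<Rightarrow> nat set list)
     \<Rightarrow> 'a list \<Rightarrow> ('n, 'm) monom list \<Rightarrow> (nat \<Rightarrow> ('n, 'a) polyring) list" where
  "term_syzygies cert lev as Ms =
     concat (map (\<lambda>E.
       map (\<lambda>s j. if j \<in> E then Poly_Mapping.single (monom_quot (monom_lcm Ms E) (Ms ! j)) (s j)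
                  else 0)
           (cert E (restrict ((!) as) E)))
       (lev Ms))"


section \<open>S-lists\<close>

definition S_list ::
  "(('n::finite, 'm::finite) monom \<Rightarrow> ('n, 'm) monom \<Rightarrow> bool)
     \<Rightarrow> (nat set \<Rightarrow> (nat \<Rightarrow> 'a::comm_ring_1) \<Rightarrow> (nat \<Rightarrow> 'a) list)
     \<Rightarrow> (('n, 'm) monom list \<Rightarrow> nat set list)
     \<Rightarrow> ('n, 'm, 'a) freemod list \<Rightarrow> ('n, 'm, 'a) freemod list" where
  "S_list gt cert lev fs =
     filter (\<lambda>v. v \<noteq> 0)
       (map (\<lambda>S. \<Sum>j<length fs. S j *s (fs ! j))
         (term_syzygies cert lev (map (LC gt) fs) (map (lead_monom gt) fs)))"

primrec iter_S_list ::
  "(('n::finite, 'm::finite) monom \<Rightarrow> ('n, 'm) monom \<Rightarrow> bool)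
     \<Rightarrow> (nat set \<Rightarrow> (nat \<Rightarrow> 'a::comm_ring_1) \<Rightarrow> (nat \<Rightarrow> 'a) list)
     \<Rightarrow> (('n, 'm) monom list \<Rightarrow> nat set list)
     \<Rightarrow> nat \<Rightarrow> ('n, 'm, 'a) freemod list \<Rightarrow> ('n, 'm, 'a) freemod list" where
  "iter_S_list gt cert lev 0 fs = fs"
| "iter_S_list gt cert lev (Suc q) fs =
     iter_S_list gt cert lev q fs @ S_list gt cert lev (iter_S_list gt cert lev q fs)"

end

theory Submission
  imports Defs
begin

text \<open>
  Why the theorem holds. Let \<open>u\<close> be a combination of the items of some \<open>ps\<close>, and let \<open>M\<close> bound the
  monomials \<open>X\<^sup>\<alpha> LM p\<close> for all summands \<open>c X\<^sup>\<alpha> p\<close> in a chosen representation of \<open>u\<close>. Look at the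
  summands that reach \<open>M\<close>; their values \<open>c LC p\<close> add up to the coefficient of \<open>u\<close> at \<open>M\<close>. If this sum is
  not zero, then \<open>M\<close> is the leading monomial of \<open>u\<close>, and the same sum of leading terms exhibits
  \<open>LT u\<close> in the span of the \<open>LT p\<close>. If it is zero, the coefficients of these summands form a syzygy of
  leading coefficients over a position level set, hence a combination of the generators that the
  coherence certificate provides. Each generator, lifted to the lcm \<open>N\<close> of the leading monomials
  involved, gives zero or an item of the S-list whose leading monomial is strictly below \<open>N\<close>. As \<open>N\<close>
  divides \<open>M\<close>, replacing the top summands by multiples of these items gives a representation of
  \<open>u\<close> over the next iterated S-list all of whose summands stay strictly below \<open>M\<close>. This dichotomy is
  \<open>LT_or_reduce\<close>; its second half is \<open>top_syzygy_reduces\<close>.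

  A monomial order is a well-order by Dickson's lemma (\<open>monomial_order_wfp\<close>), so the second
  alternative cannot recur forever, and \<open>LT u\<close> is reached after finitely many S-list steps
  (\<open>LT_in_span_iter_S_list\<close>). The number of steps depends on \<open>u\<close>, which is why only the union over
  all iterations captures the module of leading terms. That union is a submodule because it is a
  chain, and nothing outside is added because S-lists consist of combinations of the original vectors.
\<close>

section \<open>Well-foundedness of monomial orders\<close>

lemma nat_seq_mono_subseq:
  fixes s :: "nat \<Rightarrow> nat"
  obtains r :: "nat \<Rightarrow> nat" where "strict_mono r" "incseq (\<lambda>i. s (r i))"
proof -
  obtain r0 :: "nat \<Rightarrow> nat" where r0: "strict_mono r0" "monoseq (\<lambda>i. s (r0 i))"
    using seq_monosub by blast
  show thesis
  proof (cases "incseq (\<lambda>i. s (r0 i))")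
    case True
    then show thesis using that r0 by blast
  next
    case False
    then have dec: "decseq (\<lambda>i. s (r0 i))"
      using r0(2) by (simp add: monoseq_iff)
    \<comment> \<open>a decreasing sequence of naturals is constant from the point where it attains its minimum\<close>
    obtain N where N: "\<And>i. s (r0 N) \<le> s (r0 i)"
      using ex_has_least_nat[of "\<lambda>_. True" _ "\<lambda>i. s (r0 i)"] by auto
    have "s (r0 (N + i)) = s (r0 N)" for i
      using N[of "N + i"] decseqD[OF dec, of N "N + i"] by simp
    then have "incseq (\<lambda>i. s (r0 (N + i)))"
      by (simp add: incseq_def)
    moreover have "strict_mono (\<lambda>i. r0 (N + i))"
      using r0(1) by (simp add: strict_mono_def)
    ultimately show thesis using that by blast
  qed
qed

text \<open>Dickson's lemma, one coordinate at a time: each coordinate of the sequence becomes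
  nondecreasing after passing to a subsequence, and this is inherited by further subsequences.\<close>

lemma dickson_subseq:
  fixes s :: "nat \<Rightarrow> 'n \<Rightarrow> nat"
  assumes "finite K"
  shows "\<exists>r :: nat \<Rightarrow> nat. strict_mono r \<and> (\<forall>k\<in>K. incseq (\<lambda>i. s (r i) k))"
  using assms
proof (induction K)
  case empty
  show ?case by (rule exI[of _ id]) (simp add: strict_mono_def)
next
  case (insert k K)
  then obtain r where r: "strict_mono r" "\<And>k. k \<in> K \<Longrightarrow> incseq (\<lambda>i. s (r i) k)"
    by blast
  obtain r' :: "nat \<Rightarrow> nat" where r': "strict_mono r'" "incseq (\<lambda>i. s (r (r' i)) k)"
    by (rule nat_seq_mono_subseq[of "\<lambda>i. s (r i) k"])
  have "incseq (\<lambda>i. s (r (r' i)) k')" if "k' \<in> K" for k'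
    using r(2)[OF that] r'(1) unfolding incseq_def
    by (meson monoD strict_mono_mono)
  with r' r(1) show ?case
    by (intro exI[of _ "\<lambda>i. r (r' i)"]) (auto simp: strict_mono_def)
qed

definition divides :: "('n, 'm) monom \<Rightarrow> ('n, 'm) monom \<Rightarrow> bool" where
  "divides N M \<longleftrightarrow> (\<exists>\<alpha>. M = shift \<alpha> N)"

lemma shift_monom_quot: "divides N M \<Longrightarrow> shift (monom_quot M N) N = M"
  by (auto simp: divides_def shift_def monom_quot_def)

lemma monom_quot_shift [simp]: "monom_quot (shift \<alpha> N) N = \<alpha>"
  by (simp add: shift_def monom_quot_def)

lemma shift_shift: "shift \<alpha> (shift \<beta> M) = shift (\<alpha> + \<beta>) M"
  by (simp add: shift_def add.assoc)

lemma dividesI: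
  fixes M N :: "('n, 'm) monom"
  assumes "snd N = snd M"
    and le: "\<And>k. Poly_Mapping.lookup (fst N) k \<le> Poly_Mapping.lookup (fst M) k"
  shows "divides N M"
proof -
  have "M = shift (monom_quot M N) N"
    using assms by (auto simp: shift_def monom_quot_def prod_eq_iff lookup_add lookup_minus
        intro!: poly_mapping_eqI)
  then show ?thesis
    unfolding divides_def by blast
qed

lemma divides_lookup_le:
  "divides N M \<Longrightarrow> Poly_Mapping.lookup (fst N) k \<le> Poly_Mapping.lookup (fst M) k"
  by (auto simp: divides_def shift_def lookup_add)

lemma divides_snd: "divides N M \<Longrightarrow> snd N = snd M"
  by (auto simp: divides_def shift_def)

text \<open>Some position occurs infinitely often, which reduces to Dickson's lemma for one position.\<close>

lemma monom_seq_divides: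
  fixes s :: "nat \<Rightarrow> ('n::finite, 'm::finite) monom"
  obtains i j where "i < j" "divides (s i) (s j)"
proof -
  obtain i0 where inf: "infinite {i. snd (s i) = snd (s i0)}"
    using pigeonhole_infinite[of UNIV "\<lambda>i. snd (s i)"] by auto
  define e where "e = enumerate {i. snd (s i) = snd (s i0)}"
  have e: "strict_mono e" "\<And>i. snd (s (e i)) = snd (s i0)"
    using enumerate_in_set[OF inf] strict_mono_enumerate[OF inf] by (auto simp: e_def)
  obtain r :: "nat \<Rightarrow> nat" where r: "strict_mono r"
      "\<And>k. incseq (\<lambda>i. Poly_Mapping.lookup (fst (s (e (r i)))) k)"
    using dickson_subseq[of UNIV "\<lambda>i. Poly_Mapping.lookup (fst (s (e i)))"] by auto
  have "divides (s (e (r 0))) (s (e (r 1)))"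
    using e(2) incseqD[OF r(2), of 0 1] by (intro dividesI) auto
  moreover have "e (r 0) < e (r 1)"
    using e(1) r(1) by (simp add: strict_mono_def)
  ultimately show thesis using that by blast
qed

lemma divides_monom_lcm:
  assumes "position_level_set Ms E" "j \<in> E"
  shows "divides (Ms ! j) (monom_lcm Ms E)"
proof (rule dividesI)
  have fin: "finite E"
    using assms(1) by (auto simp: position_level_set_def intro: finite_subset)
  have "(THE i. \<forall>j\<in>E. snd (Ms ! j) = i) = snd (Ms ! j)"
    using assms unfolding position_level_set_def by (intro the_equality) metis+
  then show "snd (Ms ! j) = snd (monom_lcm Ms E)"
    by (simp add: monom_lcm_def)
  show "Poly_Mapping.lookup (fst (Ms ! j)) k \<le> Poly_Mapping.lookup (fst (monom_lcm Ms E)) k" for k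
    using fin assms(2) by (simp add: lookup_monom_lcm)
qed

lemma monom_lcm_divides:
  fixes Ms :: "('n::finite, 'm) monom list"
  assumes "position_level_set Ms E" "\<And>j. j \<in> E \<Longrightarrow> divides (Ms ! j) M"
  shows "divides (monom_lcm Ms E) M"
proof (rule dividesI)
  have fin: "finite E" and ne: "E \<noteq> {}"
    using assms(1) by (auto simp: position_level_set_def intro: finite_subset)
  then obtain j where j: "j \<in> E" by blast
  show "snd (monom_lcm Ms E) = snd M"
    using divides_snd[OF divides_monom_lcm[OF assms(1) j]] divides_snd[OF assms(2)[OF j]] by simp
  show "Poly_Mapping.lookup (fst (monom_lcm Ms E)) k \<le> Poly_Mapping.lookup (fst M) k" for k
    using fin ne assms(2) by (simp add: lookup_monom_lcm divides_lookup_le)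
qed


section \<open>Coefficients of vectors\<close>

lemma coefficient_zero [simp]: "coefficient 0 M = 0"
  by (simp add: coefficient_def)

lemma coefficient_add: "coefficient (u + v) M = coefficient u M + coefficient v M"
  by (simp add: coefficient_def lookup_add)

lemma coefficient_sum: "coefficient (\<Sum>j\<in>E. v j) M = (\<Sum>j\<in>E. coefficient (v j) M)"
  by (induction E rule: infinite_finite_induct) (simp_all add: coefficient_add)

lemma support_zero [simp]: "support 0 = {}"
  by (simp add: support_def)

lemma support_eq_empty [simp]: "support u = {} \<longleftrightarrow> u = 0"
  by (auto simp: support_def coefficient_def vec_eq_iff poly_mapping_eq_iff fun_eq_iff)

lemma support_add: "support (u + v) \<subseteq> support u \<union> support v"
  by (auto simp: support_def coefficient_add)

lemma single_mult_lookup: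
  fixes f :: "('n, 'a::comm_ring_1) polyring"
  shows "Poly_Mapping.lookup (Poly_Mapping.single \<alpha> c * f) (\<alpha> + \<beta>) = c * Poly_Mapping.lookup f \<beta>"
proof -
  show ?thesis
    by (simp add: lookup_mult lookup_single when_mult eq_commute[of "\<alpha> + \<beta>"])
qed

lemma coefficient_single_scale:
  "coefficient (Poly_Mapping.single \<alpha> c *s u) (shift \<alpha> M) = c * coefficient u M"
  by (simp add: coefficient_def shift_def single_mult_lookup)

lemma support_single_scale:
  "support (Poly_Mapping.single \<alpha> c *s u) \<subseteq> shift \<alpha> ` support u"
proof
  fix M assume "M \<in> support (Poly_Mapping.single \<alpha> c *s u)"
  then have "fst M \<in> Poly_Mapping.keys (Poly_Mapping.single \<alpha> c * (u $ snd M))"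
    by (simp add: support_def coefficient_def in_keys_iff)
  then obtain \<beta> where "fst M = \<alpha> + \<beta>" "\<beta> \<in> Poly_Mapping.keys (u $ snd M)"
    using keys_mult[of "Poly_Mapping.single \<alpha> c" "u $ snd M"] by (auto split: if_splits)
  then have "M = shift \<alpha> (\<beta>, snd M)" "(\<beta>, snd M) \<in> support u"
    by (auto simp: shift_def support_def coefficient_def in_keys_iff prod_eq_iff)
  then show "M \<in> shift \<alpha> ` support u" by blast
qed

lemma single_sum:
  "Poly_Mapping.single \<alpha> (\<Sum>i\<in>I. f i) = (\<Sum>i\<in>I. Poly_Mapping.single \<alpha> (f i))"
  by (induction I rule: infinite_finite_induct) (simp_all add: single_add)

lemma axis_single_sum:
  "axis i (Poly_Mapping.single \<alpha> (\<Sum>j\<in>E. f j)) = (\<Sum>j\<in>E. axis i (Poly_Mapping.single \<alpha> (f j)))"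
  by (auto simp: vec_eq_iff axis_def single_sum)

lemma polyring_sum_single:
  fixes f :: "('n, 'a::comm_ring_1) polyring"
  shows "f = (\<Sum>\<alpha>\<in>Poly_Mapping.keys f. Poly_Mapping.single \<alpha> (Poly_Mapping.lookup f \<alpha>))"
  by (rule poly_mapping_eqI) (auto simp: lookup_sum lookup_single when_def in_keys_iff)


section \<open>Combinations with bounded terms\<close>

context
  fixes gt :: "('n::finite, 'm::finite) monom \<Rightarrow> ('n, 'm) monom \<Rightarrow> bool"
begin

definition below :: "('n, 'm) monom \<Rightarrow> ('n, 'm) monom set" where
  "below M = {N. gt M N}"

definition at_most :: "('n, 'm) monom \<Rightarrow> ('n, 'm) monom set" where
  "at_most M = insert M (below M)"

text \<open>A representation is measured by the shifted leading monomials in its summands, not by the support of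
  the resulting vector: cancellation at the top is exactly what the argument exploits. Hence this is
  a set of combinations with constrained summands, closed under addition but not under
  multiplication by polynomials.\<close>

inductive_set comb ::
  "('n, 'm) monom set \<Rightarrow> ('n, 'm, 'a::comm_ring_1) freemod set \<Rightarrow> ('n, 'm, 'a) freemod set"
  for A P where
  zero: "0 \<in> comb A P"
| add_term: "\<lbrakk>u \<in> comb A P; p \<in> P; shift \<alpha> (lead_monom gt p) \<in> A\<rbrakk>
    \<Longrightarrow> u + Poly_Mapping.single \<alpha> c *s p \<in> comb A P"

lemma comb_mono:
  assumes "u \<in> comb A P" "A \<subseteq> B" "P \<subseteq> Q"
  shows "u \<in> comb B Q"
  using assms by (induction) (auto intro: comb.intros)

lemma comb_add:
  assumes "v \<in> comb A P" "u \<in> comb A P"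
  shows "u + v \<in> comb A P"
  using assms
proof (induction)
  case (add_term v p \<alpha> c)
  then show ?case
    using comb.add_term[of "u + v"] by (simp add: add.assoc)
qed simp

lemma comb_sum: "(\<And>j. j \<in> E \<Longrightarrow> v j \<in> comb A P) \<Longrightarrow> (\<Sum>j\<in>E. v j) \<in> comb A P"
  by (induction E rule: infinite_finite_induct) (auto intro: comb.zero comb_add)

lemma comb_single:
  "p \<in> P \<Longrightarrow> shift \<alpha> (lead_monom gt p) \<in> A \<Longrightarrow> Poly_Mapping.single \<alpha> c *s p \<in> comb A P"
  using comb.add_term[OF comb.zero, of p P \<alpha> A c] by simp

lemma span_subset_comb: "freemod.span P \<subseteq> comb UNIV P"
proof
  fix u assume "u \<in> freemod.span P"
  then show "u \<in> comb UNIV P"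
  proof (induction rule: freemod.span_induct_alt)
    case base
    show ?case by (rule comb.zero)
  next
    case (step c x y)
    have "c *s x = (\<Sum>\<alpha>\<in>Poly_Mapping.keys c. Poly_Mapping.single \<alpha> (Poly_Mapping.lookup c \<alpha>) *s x)"
      by (simp flip: freemod.scale_sum_left polyring_sum_single)
    then have "c *s x \<in> comb UNIV P"
      using step by (auto intro!: comb_sum comb_single)
    then show ?case
      using step comb_add by blast
  qed
qed

text \<open>Summands attaining the bound can be collected into one per item, because \<open>M\<close> and the
  leading monomial of the item determine the exponent by which the item is shifted. Indices are
  used instead of the items themselves since the syzygies of a list refer to indices. The index set
  includes items whose collected coefficient is zero.\<close>

lemma comb_at_most_split:
  assumes "u \<in> comb (at_most M) (set ps)"
  obtains c r where "r \<in> comb (below M) (set ps)"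
    "u = (\<Sum>j | j < length ps \<and> divides (lead_monom gt (ps ! j)) M.
        Poly_Mapping.single (monom_quot M (lead_monom gt (ps ! j))) (c j) *s (ps ! j)) + r"
proof -
  let ?E = "{j. j < length ps \<and> divides (lead_monom gt (ps ! j)) M}"
  let ?t = "\<lambda>j a. Poly_Mapping.single (monom_quot M (lead_monom gt (ps ! j))) a *s (ps ! j)"
  have "\<exists>c r. r \<in> comb (below M) (set ps) \<and> u = (\<Sum>j\<in>?E. ?t j (c j)) + r"
    using assms
  proof induction
    case zero
    show ?case
      by (intro exI[of _ "\<lambda>_. 0"] exI[of _ 0]) (simp add: comb.zero)
  next
    case (add_term u p \<alpha> a)
    then obtain c r where cr: "r \<in> comb (below M) (set ps)" "u = (\<Sum>j\<in>?E. ?t j (c j)) + r"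
      by blast
    consider "shift \<alpha> (lead_monom gt p) = M" | "shift \<alpha> (lead_monom gt p) \<in> below M"
      using add_term.hyps by (auto simp: at_most_def)
    then show ?case
    proof cases
      case 1
      obtain k where k: "k < length ps" "p = ps ! k"
        using add_term.hyps by (auto simp: in_set_conv_nth)
      then have kE: "k \<in> ?E" and fin: "finite ?E"
        using 1 by (auto simp: divides_def)
      have \<alpha>: "monom_quot M (lead_monom gt (ps ! k)) = \<alpha>"
        using 1 k by auto
      have "(\<Sum>j\<in>?E. ?t j ((c(k := c k + a)) j))
          = (\<Sum>j\<in>?E. ?t j (c j)) + ?t k a"
      proof -
        have "(\<Sum>j\<in>?E. ?t j ((c(k := c k + a)) j))
            = (\<Sum>j\<in>?E. ?t j (c j) + (if j = k then ?t k a else 0))"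
          by (intro sum.cong) (auto simp: single_add freemod.scale_left_distrib)
        also have "\<dots> = (\<Sum>j\<in>?E. ?t j (c j)) + ?t k a"
          unfolding sum.distrib sum.delta[OF fin] using kE by (simp only: if_True)
        finally show ?thesis .
      qed
      then have "u + Poly_Mapping.single \<alpha> a *s p = (\<Sum>j\<in>?E. ?t j ((c(k := c k + a)) j)) + r"
        unfolding cr(2) k(2) \<alpha> by (simp only: add_ac)
      with cr(1) show ?thesis by blast
    next
      case 2
      then have "r + Poly_Mapping.single \<alpha> a *s p \<in> comb (below M) (set ps)"
        using cr add_term.hyps by (intro comb.add_term)
      moreover have "u + Poly_Mapping.single \<alpha> a *s p
          = (\<Sum>j\<in>?E. ?t j (c j)) + (r + Poly_Mapping.single \<alpha> a *s p)"
        unfolding cr(2) by (rule add.assoc)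
      ultimately show ?thesis by blast
    qed
  qed
  then show thesis using that by blast
qed

end


section \<open>Leading terms\<close>

context
  fixes gt :: "('n::finite, 'm::finite) monom \<Rightarrow> ('n, 'm) monom \<Rightarrow> bool"
  assumes order: "monomial_order gt"
begin

lemma gt_irrefl: "\<not> gt M M"
  using order unfolding monomial_order_def irreflp_def by blast

lemma gt_trans: "gt L M \<Longrightarrow> gt M N \<Longrightarrow> gt L N"
  using order unfolding monomial_order_def by (blast dest: transpD)

lemma gt_total: "M \<noteq> N \<Longrightarrow> gt M N \<or> gt N M"
  using order unfolding monomial_order_def by (blast dest: totalpD)

lemma gt_shift: "gt M N \<Longrightarrow> gt (shift \<alpha> M) (shift \<alpha> N)"
  using order unfolding monomial_order_def by blast

lemma divides_not_gt:
  assumes "divides N M"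
  shows "\<not> gt N M"
proof -
  obtain \<alpha> where \<alpha>: "M = shift \<alpha> N"
    using assms by (auto simp: divides_def)
  have "M = N \<or> gt M N"
  proof (cases "\<alpha> = 0")
    case True
    then show ?thesis by (simp add: \<alpha> shift_def)
  next
    case False
    then show ?thesis using order unfolding monomial_order_def \<alpha> by blast
  qed
  then show ?thesis
    using gt_irrefl gt_trans by blast
qed

text \<open>In an infinite descending chain some monomial would divide a later and smaller one.\<close>

lemma monomial_order_wfp: "wfp (\<lambda>N M. gt M N)"
proof -
  have "\<not> (\<forall>i. gt (s i) (s (Suc i)))" for s
  proof
    assume desc: "\<forall>i. gt (s i) (s (Suc i))"
    obtain i j where ij: "i < j" "divides (s i) (s j)"
      by (rule monom_seq_divides)
    have "gt (s i) (s j)"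
      using ij(1) by (induction rule: less_Suc_induct) (use desc gt_trans in blast)+
    then show False
      using divides_not_gt ij(2) by blast
  qed
  then show ?thesis
    by (simp add: wfp_def wf_iff_no_infinite_down_chain)
qed

lemma below_trans: "N \<in> at_most gt M \<Longrightarrow> below gt N \<subseteq> below gt M"
  by (auto simp: below_def at_most_def intro: gt_trans)

lemma at_most_mono: "N \<in> at_most gt M \<Longrightarrow> at_most gt N \<subseteq> at_most gt M"
  using below_trans unfolding at_most_def by blast

lemma at_most_linear: "M \<in> at_most gt N \<or> N \<in> at_most gt M"
  using gt_total unfolding at_most_def below_def by blast

lemma lead_monom_eqI:
  assumes M: "M \<in> support u" and le: "support u \<subseteq> at_most gt M"
  shows "lead_monom gt u = M"
  unfolding lead_monom_def
proof (rule the_equality)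
  show "M \<in> support u \<and> (\<forall>N\<in>support u. N \<noteq> M \<longrightarrow> gt M N)"
    using M le unfolding at_most_def below_def by blast
next
  fix L assume L: "L \<in> support u \<and> (\<forall>N\<in>support u. N \<noteq> L \<longrightarrow> gt L N)"
  show "L = M"
  proof (rule ccontr)
    assume "L \<noteq> M"
    then have "gt L M" "gt M L"
      using L M le by (auto simp: at_most_def below_def)
    then have "gt L L"
      by (rule gt_trans)
    with gt_irrefl show False ..
  qed
qed

lemma finite_has_max:
  assumes "finite A" "A \<noteq> {}"
  obtains M where "M \<in> A" "A \<subseteq> at_most gt M"
proof -
  have "\<exists>M\<in>A. A \<subseteq> at_most gt M"
    using assms
  proof (induction rule: finite_ne_induct)
    case (singleton M)
    show ?case by (simp add: at_most_def)
  next
    case (insert N A)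
    then obtain M where M: "M \<in> A" "A \<subseteq> at_most gt M" by blast
    show ?case
    proof (cases "N \<in> at_most gt M")
      case True
      then show ?thesis using M by blast
    next
      case False
      then have "M \<in> at_most gt N" using at_most_linear by blast
      then show ?thesis
        using M at_most_mono[of M N] by (auto simp: at_most_def)
    qed
  qed
  then show thesis using that by blast
qed

lemma lead_monom:
  fixes u :: "('n, 'm, 'a::comm_ring_1) freemod"
  assumes "u \<noteq> 0"
  shows "lead_monom gt u \<in> support u" "support u \<subseteq> at_most gt (lead_monom gt u)"
proof -
  obtain M where "M \<in> support u" "support u \<subseteq> at_most gt M"
    using finite_has_max[OF finite_support, of u] assms by auto
  moreover from this have "lead_monom gt u = M"
    by (rule lead_monom_eqI)
  ultimately show "lead_monom gt u \<in> support u" "support u \<subseteq> at_most gt (lead_monom gt u)"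
    by simp_all
qed

lemma LT_zero [simp]: "LT gt (0 :: ('n, 'm, 'a::comm_ring_1) freemod) = 0"
  by (simp add: LT_def LM_def)

lemma LT_eq_axis:
  fixes u :: "('n, 'm, 'a::comm_ring_1) freemod"
  assumes "M \<in> support u" "support u \<subseteq> at_most gt M"
  shows "LT gt u = axis (snd M) (Poly_Mapping.single (fst M) (coefficient u M))"
proof -
  have "u \<noteq> 0" using assms(1) by auto
  then have "LC gt u = coefficient u M" "LM gt u = monom_vec M"
    by (simp_all add: LC_def LM_def lead_monom_eqI[OF assms])
  then have "LT gt u = Poly_Mapping.single 0 (coefficient u M)
      *s axis (snd M) (Poly_Mapping.single (fst M) 1)"
    unfolding LT_def monom_vec_def const_poly_def by (simp only:)
  also have "\<dots> = axis (snd M) (Poly_Mapping.single (fst M) (coefficient u M))"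
    by (simp add: vec_eq_iff axis_def mult_single)
  finally show ?thesis .
qed

lemma support_shifted:
  fixes p :: "('n, 'm, 'a::comm_ring_1) freemod"
  shows "support (Poly_Mapping.single \<alpha> c *s p) \<subseteq> at_most gt (shift \<alpha> (lead_monom gt p))"
proof (cases "p = 0")
  case False
  then show ?thesis
    using support_single_scale[of \<alpha> c p] lead_monom(2)[of p] gt_shift
    by (fastforce simp: at_most_def below_def)
qed simp

text \<open>This serves both for the top summands of a representation and for the items of an S-list:
  no monomial can exceed the common lifted leading monomial \<open>N\<close>, so whether \<open>N\<close> itself
  survives is decided by the leading coefficients alone.\<close>

lemma lifted_sum:
  fixes ps :: "('n, 'm, 'a::comm_ring_1) freemod list" and c :: "nat \<Rightarrow> 'a"
  assumes nz: "0 \<notin> set ps" and E: "E \<subseteq> {..<length ps}"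
    and div: "\<And>j. j \<in> E \<Longrightarrow> divides (lead_monom gt (ps ! j)) N"
  defines "v \<equiv> \<Sum>j\<in>E. Poly_Mapping.single (monom_quot N (lead_monom gt (ps ! j))) (c j) *s (ps ! j)"
  shows "support v \<subseteq> at_most gt N"
    and "coefficient v N = (\<Sum>j\<in>E. c j * LC gt (ps ! j))"
proof -
  let ?t = "\<lambda>j. Poly_Mapping.single (monom_quot N (lead_monom gt (ps ! j))) (c j) *s (ps ! j)"
  have sh: "shift (monom_quot N (lead_monom gt (ps ! j))) (lead_monom gt (ps ! j)) = N"
    if "j \<in> E" for j
    using shift_monom_quot div that by blast
  have "support (?t j) \<subseteq> at_most gt N" if "j \<in> E" for j
    using support_shifted sh[OF that] by metis
  then have "coefficient (?t j) L = 0" if "j \<in> E" "L \<notin> at_most gt N" for j L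
    using that by (auto simp: support_def)
  then show "support v \<subseteq> at_most gt N"
    by (auto simp: v_def support_def coefficient_sum intro: ccontr)
  have "coefficient (?t j) N = c j * LC gt (ps ! j)" if "j \<in> E" for j
  proof -
    have "ps ! j \<noteq> 0" using nz E that by (metis lessThan_iff nth_mem subsetD)
    then show ?thesis
      using coefficient_single_scale[of "monom_quot N (lead_monom gt (ps ! j))" "c j" "ps ! j"
          "lead_monom gt (ps ! j)"] sh[OF that] by (simp add: LC_def)
  qed
  then show "coefficient v N = (\<Sum>j\<in>E. c j * LC gt (ps ! j))"
    by (simp add: v_def coefficient_sum)
qed

lemma LT_nonzero_eq:
  fixes u :: "('n, 'm, 'a::comm_ring_1) freemod"
  assumes "u \<noteq> 0"
  shows "LT gt u = axis (snd (lead_monom gt u)) (Poly_Mapping.single (fst (lead_monom gt u)) (LC gt u))"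
  using LT_eq_axis[OF lead_monom[OF assms]] assms by (simp add: LC_def)

lemma lifted_LT:
  fixes p :: "('n, 'm, 'a::comm_ring_1) freemod"
  assumes "p \<noteq> 0" "divides (lead_monom gt p) M"
  shows "Poly_Mapping.single (monom_quot M (lead_monom gt p)) c *s LT gt p
    = axis (snd M) (Poly_Mapping.single (fst M) (c * LC gt p))"
proof -
  have "monom_quot M (lead_monom gt p) + fst (lead_monom gt p) = fst M"
    "snd (lead_monom gt p) = snd M"
    using arg_cong[OF shift_monom_quot[OF assms(2)], of fst]
      arg_cong[OF shift_monom_quot[OF assms(2)], of snd] by (simp_all add: shift_def)
  then show ?thesis
    by (simp add: LT_nonzero_eq[OF assms(1)] vec_eq_iff axis_def mult_single)
qed

lemma comb_support:
  fixes u :: "('n, 'm, 'a::comm_ring_1) freemod"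
  assumes "u \<in> comb gt A P" and "\<And>N. N \<in> A \<Longrightarrow> at_most gt N \<subseteq> A"
  shows "support u \<subseteq> A"
  using assms(1)
proof induction
  case (add_term u p \<alpha> c)
  then show ?case
    using support_add[of u "Poly_Mapping.single \<alpha> c *s p"] support_shifted[of \<alpha> c p] assms(2)
    by blast
qed simp

text \<open>Finitely many terms occur in a combination, so one of them bounds the others.\<close>

lemma comb_bound:
  fixes u :: "('n, 'm, 'a::comm_ring_1) freemod"
  assumes "u \<in> comb gt A P"
  shows "u = 0 \<or> (\<exists>M\<in>A. u \<in> comb gt (at_most gt M) P)"
  using assms
proof induction
  case (add_term u p \<alpha> c)
  let ?N = "shift \<alpha> (lead_monom gt p)"
  have t: "Poly_Mapping.single \<alpha> c *s p \<in> comb gt (at_most gt ?N) P"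
    using add_term.hyps by (intro comb_single) (auto simp: at_most_def)
  from add_term.IH show ?case
  proof
    assume "u = 0"
    then show ?thesis using t add_term.hyps by auto
  next
    assume "\<exists>M\<in>A. u \<in> comb gt (at_most gt M) P"
    then obtain M where M: "M \<in> A" "u \<in> comb gt (at_most gt M) P" by blast
    from at_most_linear[of M ?N] show ?thesis
    proof
      assume "M \<in> at_most gt ?N"
      then have "u \<in> comb gt (at_most gt ?N) P"
        using comb_mono[OF M(2)] at_most_mono by blast
      then show ?thesis using comb_add[OF t] add_term.hyps by blast
    next
      assume "?N \<in> at_most gt M"
      then have "Poly_Mapping.single \<alpha> c *s p \<in> comb gt (at_most gt M) P"
        using comb_mono[OF t] at_most_mono by blast
      then show ?thesis using comb_add M by blast
    qed
  qed
qed simp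


section \<open>Elimination of the top terms\<close>

text \<open>In the S-list the sum runs over all indices with zero coefficients outside the level set,
  whereas the argument needs the sum over the level set.\<close>

lemma S_list_mem:
  fixes ps :: "('n, 'm, 'a::comm_ring_1) freemod list"
  assumes E: "E \<in> set (lev (map (lead_monom gt) ps))" and sub: "E \<subseteq> {..<length ps}"
    and s: "(s :: nat \<Rightarrow> 'a) \<in> set (cert E (restrict ((!) (map (LC gt) ps)) E))"
  defines "v \<equiv> \<Sum>j\<in>E. Poly_Mapping.single
      (monom_quot (monom_lcm (map (lead_monom gt) ps) E) (lead_monom gt (ps ! j))) (s j) *s (ps ! j)"
  assumes "v \<noteq> 0"
  shows "v \<in> set (S_list gt cert lev ps)"
proof -
  let ?Ms = "map (lead_monom gt) ps"
  let ?S = "\<lambda>j. if j \<in> E then Poly_Mapping.single (monom_quot (monom_lcm ?Ms E) (?Ms ! j)) (s j) else 0"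
  have mem: "?S \<in> set (term_syzygies cert lev (map (LC gt) ps) ?Ms)"
    unfolding term_syzygies_def set_concat set_map
    by (rule UN_I[OF imageI[OF E]], unfold set_map, rule image_eqI[OF _ s], rule refl)
  have v: "v = (\<Sum>j<length ps. ?S j *s (ps ! j))"
  proof -
    have "(\<Sum>j<length ps. ?S j *s (ps ! j)) = (\<Sum>j\<in>E. ?S j *s (ps ! j))"
      using sub by (intro sum.mono_neutral_right) auto
    also have "\<dots> = v"
      unfolding v_def using sub by (intro sum.cong) auto
    finally show ?thesis by simp
  qed
  have "v \<in> (\<lambda>S. \<Sum>j<length ps. S j *s (ps ! j))
      ` set (term_syzygies cert lev (map (LC gt) ps) ?Ms)"
    by (rule image_eqI[where x = ?S, OF _ mem]) (rule v)
  then show ?thesis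
    using \<open>v \<noteq> 0\<close> unfolding S_list_def set_filter set_map by (intro CollectI conjI)
qed

text \<open>The syzygy condition makes the top cancel. The lift to \<open>M\<close> factors through the lcm \<open>N\<close> of
  the leading monomials, so writing the syzygy in the certified generators expresses the sum by
  multiples of S-list items; in each item the monomial \<open>N\<close> has cancelled, and this strict decrease
  survives the shift from \<open>N\<close> to \<open>M\<close>.\<close>

lemma top_syzygy_reduces:
  fixes ps :: "('n, 'm, 'a::comm_ring_1) freemod list"
  assumes cert: "coherence_certificate cert" and lev: "level_set_enumeration lev"
    and nz: "0 \<notin> set ps"
    and E: "E \<subseteq> {..<length ps}" and div: "\<And>j. j \<in> E \<Longrightarrow> divides (lead_monom gt (ps ! j)) M"
    and syz: "(\<Sum>j\<in>E. c j * LC gt (ps ! j)) = 0"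
  shows "(\<Sum>j\<in>E. Poly_Mapping.single (monom_quot M (lead_monom gt (ps ! j))) (c j) *s (ps ! j))
    \<in> comb gt (below gt M) (set (S_list gt cert lev ps))"
proof (cases "E = {}")
  case True
  then show ?thesis by (simp add: comb.zero)
next
  case False
  let ?Ms = "map (lead_monom gt) ps"
  let ?a = "restrict ((!) (map (LC gt) ps)) E"
  define L where "L = cert E ?a"
  define N where "N = monom_lcm ?Ms E"
  define \<beta> where "\<beta> = monom_quot M N"
  have fin: "finite E" using E by (rule finite_subset) simp
  have lt: "j < length ps" if "j \<in> E" for j using E that by auto
  have pls: "position_level_set ?Ms E"
  proof -
    have "snd (?Ms ! j) = snd M" if "j \<in> E" for j
      using divides_snd[OF div[OF that]] lt[OF that] by simp
    then show ?thesis
      using False E unfolding position_level_set_def by (intro conjI ballI) simp_all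
  qed
  then have Elev: "E \<in> set (lev ?Ms)"
    using lev by (auto simp: level_set_enumeration_def)
  have divN: "divides (lead_monom gt (ps ! j)) N" if "j \<in> E" for j
    using divides_monom_lcm[OF pls that] lt[OF that] by (simp add: N_def)
  have NM: "divides N M"
    unfolding N_def by (rule monom_lcm_divides[OF pls]) (simp add: div lt)
  then have M: "M = shift \<beta> N"
    by (simp add: \<beta>_def shift_monom_quot)
  have quot: "monom_quot M (lead_monom gt (ps ! j)) = \<beta> + monom_quot N (lead_monom gt (ps ! j))"
    if "j \<in> E" for j
  proof -
    have "M = shift (\<beta> + monom_quot N (lead_monom gt (ps ! j))) (lead_monom gt (ps ! j))"
      unfolding shift_shift[symmetric] shift_monom_quot[OF divN[OF that]] by (rule M)
    then show ?thesis
      using monom_quot_shift by metis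
  qed
  have gen: "generates_Syz E ?a L"
    using cert fin unfolding coherence_certificate_def L_def by simp
  have "restrict c E \<in> Syz E ?a"
    using syz lt by (simp add: Syz_def)
  then obtain b where b: "\<And>j. j \<in> E \<Longrightarrow> c j = (\<Sum>i<length L. b i * (L ! i) j)"
    using gen unfolding generates_Syz_def by fastforce
  define v where "v i = (\<Sum>j\<in>E.
      Poly_Mapping.single (monom_quot N (lead_monom gt (ps ! j))) ((L ! i) j) *s (ps ! j))" for i
  have "(\<Sum>j\<in>E. Poly_Mapping.single (monom_quot M (lead_monom gt (ps ! j))) (c j) *s (ps ! j))
      = (\<Sum>j\<in>E. \<Sum>i<length L. Poly_Mapping.single \<beta> (b i) *s
          (Poly_Mapping.single (monom_quot N (lead_monom gt (ps ! j))) ((L ! i) j) *s (ps ! j)))"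
  proof (rule sum.cong[OF refl])
    fix j assume j: "j \<in> E"
    show "Poly_Mapping.single (monom_quot M (lead_monom gt (ps ! j))) (c j) *s (ps ! j)
      = (\<Sum>i<length L. Poly_Mapping.single \<beta> (b i) *s
          (Poly_Mapping.single (monom_quot N (lead_monom gt (ps ! j))) ((L ! i) j) *s (ps ! j)))"
      by (simp add: quot[OF j] b[OF j] single_sum freemod.scale_sum_left mult_single)
  qed
  also have "\<dots> = (\<Sum>i<length L. Poly_Mapping.single \<beta> (b i) *s v i)"
    by (subst sum.swap) (simp add: v_def freemod.scale_sum_right)
  also have "\<dots> \<in> comb gt (below gt M) (set (S_list gt cert lev ps))"
  proof (rule comb_sum)
    fix i assume i: "i \<in> {..<length L}"
    show "Poly_Mapping.single \<beta> (b i) *s v i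
        \<in> comb gt (below gt M) (set (S_list gt cert lev ps))"
    proof (cases "v i = 0")
      case True
      then show ?thesis by (simp add: comb.zero)
    next
      case nzv: False
      have Li: "L ! i \<in> set L" using i by simp
      then have "v i \<in> set (S_list gt cert lev ps)"
        using S_list_mem[of E lev ps "L ! i" cert, OF Elev E] nzv by (simp add: L_def v_def N_def)
      moreover have "lead_monom gt (v i) \<in> below gt N"
      proof -
        have "L ! i \<in> Syz E ?a"
          using gen Li by (auto simp: generates_Syz_def)
        then have "(\<Sum>j\<in>E. (L ! i) j * LC gt (ps ! j)) = 0"
          using lt by (simp add: Syz_def)
        then have "coefficient (v i) N = 0"
          using lifted_sum(2)[OF nz E divN, of "L ! i"] by (simp add: v_def)
        moreover have "support (v i) \<subseteq> at_most gt N"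
          using lifted_sum(1)[OF nz E divN, of "L ! i"] by (simp add: v_def)
        ultimately show ?thesis
          using lead_monom(1)[OF nzv] by (auto simp: at_most_def support_def)
      qed
      then have "shift \<beta> (lead_monom gt (v i)) \<in> below gt M"
        using gt_shift by (simp add: below_def M)
      ultimately show ?thesis
        by (rule comb_single)
    qed
  qed
  finally show ?thesis .
qed

text \<open>The case distinction is on the coefficient of \<open>u\<close> at the bound \<open>M\<close>.\<close>

lemma LT_or_reduce:
  fixes u :: "('n, 'm, 'a::comm_ring_1) freemod"
  assumes cert: "coherence_certificate cert" and lev: "level_set_enumeration lev"
    and nz: "0 \<notin> set ps" and u: "u \<in> comb gt (at_most gt M) (set ps)"
  shows "LT gt u \<in> freemod.span (LT gt ` set ps) \<or>
    u \<in> comb gt (below gt M) (set (ps @ S_list gt cert lev ps))"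
proof -
  let ?E = "{j. j < length ps \<and> divides (lead_monom gt (ps ! j)) M}"
  obtain c r where r: "r \<in> comb gt (below gt M) (set ps)"
    and ur: "u = (\<Sum>j\<in>?E. Poly_Mapping.single (monom_quot M (lead_monom gt (ps ! j))) (c j) *s (ps ! j)) + r"
    by (rule comb_at_most_split[OF u])
  have E: "?E \<subseteq> {..<length ps}" and div: "\<And>j. j \<in> ?E \<Longrightarrow> divides (lead_monom gt (ps ! j)) M"
    by auto
  have "support r \<subseteq> below gt M"
  proof (rule comb_support[OF r])
    show "at_most gt N \<subseteq> below gt M" if "N \<in> below gt M" for N
      using that below_trans[of N M] unfolding at_most_def by blast
  qed
  then have "coefficient r M = 0"
    using gt_irrefl[of M] by (auto simp: support_def below_def)
  then have coeff: "coefficient u M = (\<Sum>j\<in>?E. c j * LC gt (ps ! j))"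
    using lifted_sum(2)[OF nz E div, of c] by (simp add: ur coefficient_add)
  show ?thesis
  proof (cases "coefficient u M = 0")
    case True
    then have "(\<Sum>j\<in>?E. c j * LC gt (ps ! j)) = 0"
      using coeff by simp
    note red = top_syzygy_reduces[OF cert lev nz E div this]
    have "u \<in> comb gt (below gt M) (set (ps @ S_list gt cert lev ps))"
      unfolding ur set_append
      by (intro comb_add comb_mono[OF r] comb_mono[OF red] order.refl Un_upper1 Un_upper2)
    then show ?thesis ..
  next
    case False
    have "support u \<subseteq> at_most gt M"
      by (rule comb_support[OF u]) (rule at_most_mono)
    moreover have "M \<in> support u"
      using False by (simp add: support_def)
    ultimately have "LT gt u = axis (snd M) (Poly_Mapping.single (fst M) (\<Sum>j\<in>?E. c j * LC gt (ps ! j)))"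
      using LT_eq_axis[of M u] by (simp only: coeff)
    also have "\<dots> = (\<Sum>j\<in>?E. axis (snd M) (Poly_Mapping.single (fst M) (c j * LC gt (ps ! j))))"
      by (rule axis_single_sum)
    also have "\<dots> = (\<Sum>j\<in>?E. Poly_Mapping.single (monom_quot M (lead_monom gt (ps ! j))) (c j)
        *s LT gt (ps ! j))"
    proof (intro sum.cong refl lifted_LT[symmetric])
      show "ps ! j \<noteq> 0" if "j \<in> ?E" for j
        using nz that by (metis (mono_tags) mem_Collect_eq nth_mem)
    qed blast
    also have "\<dots> \<in> freemod.span (LT gt ` set ps)"
      by (intro freemod.span_sum freemod.span_scale freemod.span_base) auto
    finally show ?thesis ..
  qed
qed

lemma S_list_nonzero: "0 \<notin> set (S_list gt cert lev ps)"
  by (simp add: S_list_def)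

lemma iter_S_list_nonzero: "0 \<notin> set fs \<Longrightarrow> 0 \<notin> set (iter_S_list gt cert lev q fs)"
  by (induction q) (auto simp: S_list_nonzero)

text \<open>Well-founded induction on the bound of a representation. The iteration index must be
  arbitrary, because every decrease of the bound moves the representation to the next S-list.\<close>

lemma LT_in_span_iter_S_list:
  fixes u :: "('n, 'm, 'a::comm_ring_1) freemod"
  assumes cert: "coherence_certificate cert" and lev: "level_set_enumeration lev"
    and nz: "0 \<notin> set fs" and u: "u \<in> freemod.span (set fs)"
  shows "\<exists>q. LT gt u \<in> freemod.span (LT gt ` set (iter_S_list gt cert lev q fs))"
proof -
  have main: "\<exists>q. LT gt u \<in> freemod.span (LT gt ` set (iter_S_list gt cert lev q fs))"
    if "u \<in> comb gt (at_most gt M) (set (iter_S_list gt cert lev q fs))" for M q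
    using monomial_order_wfp that
  proof (induction M arbitrary: q rule: wfp_induct_rule)
    case (less M)
    consider "LT gt u \<in> freemod.span (LT gt ` set (iter_S_list gt cert lev q fs))"
      | "u \<in> comb gt (below gt M) (set (iter_S_list gt cert lev (Suc q) fs))"
      using LT_or_reduce[OF cert lev iter_S_list_nonzero[OF nz] less.prems]
      unfolding iter_S_list.simps by blast
    then show ?case
    proof cases
      case 2
      from comb_bound[OF this] show ?thesis
      proof
        assume "u = 0"
        then show ?thesis by (simp add: freemod.span_zero)
      next
        assume "\<exists>N\<in>below gt M. u \<in> comb gt (at_most gt N) (set (iter_S_list gt cert lev (Suc q) fs))"
        then obtain N where "gt M N"
          "u \<in> comb gt (at_most gt N) (set (iter_S_list gt cert lev (Suc q) fs))"
          by (auto simp only: below_def)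
        then show ?thesis by (rule less.IH)
      qed
    qed blast
  qed
  have "u \<in> comb gt UNIV (set (iter_S_list gt cert lev 0 fs))"
    using u span_subset_comb by auto
  from comb_bound[OF this] show ?thesis
  proof
    assume "u = 0"
    then show ?thesis by (simp add: freemod.span_zero)
  next
    assume "\<exists>M\<in>UNIV. u \<in> comb gt (at_most gt M) (set (iter_S_list gt cert lev 0 fs))"
    then obtain M where "u \<in> comb gt (at_most gt M) (set (iter_S_list gt cert lev 0 fs))" ..
    then show ?thesis by (rule main)
  qed
qed

end

section \<open>The chain of iterated S-lists\<close>

lemma S_list_subset_span:
  "set (S_list gt cert lev ps) \<subseteq> freemod.span (set ps)"
proof -
  have "(\<Sum>j<length ps. S j *s (ps ! j)) \<in> freemod.span (set ps)" for S
    by (rule freemod.span_sum, rule freemod.span_scale, rule freemod.span_base) simp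
  then show ?thesis
    unfolding S_list_def set_filter set_map by (intro subsetI, elim CollectE conjE imageE) simp
qed

lemma iter_S_list_subset_span:
  "set (iter_S_list gt cert lev q fs) \<subseteq> freemod.span (set fs)"
proof (induction q)
  case 0
  show ?case by (simp add: freemod.span_superset)
next
  case (Suc q)
  then have "freemod.span (set (iter_S_list gt cert lev q fs)) \<subseteq> freemod.span (set fs)"
    by (intro freemod.span_minimal freemod.subspace_span)
  with S_list_subset_span
  have "set (S_list gt cert lev (iter_S_list gt cert lev q fs)) \<subseteq> freemod.span (set fs)"
    by (rule order.trans)
  with Suc show ?case
    by (simp only: iter_S_list.simps set_append Un_least)
qed

lemma incseq_iter_S_list: "incseq (\<lambda>q. set (iter_S_list gt cert lev q fs))"
  by (rule incseq_SucI) simp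

lemma subspace_UN_incseq:
  fixes V :: "nat \<Rightarrow> ('b::comm_ring_1 ^ 'm) set"
  assumes "incseq V" "\<And>q. freemod.subspace (V q)"
  shows "freemod.subspace (\<Union>q. V q)"
proof (rule freemod.subspaceI)
  show "0 \<in> (\<Union>q. V q)"
    using assms(2) freemod.subspace_0 by blast
  show "x + y \<in> (\<Union>q. V q)" if "x \<in> (\<Union>q. V q)" "y \<in> (\<Union>q. V q)" for x y
  proof -
    from that obtain i j where "x \<in> V i" "y \<in> V j" by blast
    then have "x \<in> V (max i j)" "y \<in> V (max i j)"
      using incseqD[OF assms(1)] by (meson max.cobounded1 max.cobounded2 subsetD)+
    then show ?thesis
      using freemod.subspace_add[OF assms(2)] by blast
  qed
  show "c *s x \<in> (\<Union>q. V q)" if "x \<in> (\<Union>q. V q)" for c x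
    using that freemod.subspace_scale[OF assms(2)] by blast
qed

theorem mainTheorem1:
  fixes gt :: "('n::finite, 'm::finite) monom \<Rightarrow> ('n, 'm) monom \<Rightarrow> bool"
    and cert :: "nat set \<Rightarrow> (nat \<Rightarrow> 'a::comm_ring_1) \<Rightarrow> (nat \<Rightarrow> 'a) list"
    and lev :: "('n, 'm) monom list \<Rightarrow> nat set list"
    and fs :: "('n, 'm, 'a) freemod list"
  assumes "coherent TYPE('a)"
    and "coherence_certificate cert"
    and "level_set_enumeration lev"
    and "monomial_order gt"
    and "fs \<noteq> []"
    and "\<forall>f\<in>set fs. f \<noteq> 0"
  shows "(\<forall>u\<in>freemod.span (set fs).
            \<exists>q ps. set ps \<subseteq> set (iter_S_list gt cert lev q fs) \<and>
                   LT gt u \<in> freemod.span (set (map (LT gt) ps))) \<and>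
         MLT gt (freemod.span (set fs)) =
           (\<Union>q. freemod.span (set (map (LT gt) (iter_S_list gt cert lev q fs)))) \<and>
         incseq (\<lambda>q. freemod.span (set (map (LT gt) (iter_S_list gt cert lev q fs))))"
proof -
  let ?L = "\<lambda>q. iter_S_list gt cert lev q fs"
  let ?V = "\<lambda>q. freemod.span (set (map (LT gt) (?L q)))"
  have nz: "0 \<notin> set fs" using assms(6) by blast
  have LT: "\<exists>q. LT gt u \<in> ?V q" if "u \<in> freemod.span (set fs)" for u
    using LT_in_span_iter_S_list[OF assms(4,2,3) nz that] by simp
  have inc: "incseq ?V"
    unfolding incseq_def set_map
    by (intro allI impI freemod.span_mono image_mono incseqD[OF incseq_iter_S_list])
  have "MLT gt (freemod.span (set fs)) \<subseteq> (\<Union>q. ?V q)"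
    unfolding MLT_def
  proof (rule freemod.span_minimal)
    show "{LT gt u |u. u \<in> freemod.span (set fs)} \<subseteq> (\<Union>q. ?V q)"
      using LT by blast
    show "freemod.subspace (\<Union>q. ?V q)"
      by (rule subspace_UN_incseq[OF inc]) (rule freemod.subspace_span)
  qed
  moreover have "?V q \<subseteq> MLT gt (freemod.span (set fs))" for q
    unfolding MLT_def set_map using iter_S_list_subset_span by (intro freemod.span_mono) blast
  ultimately have "MLT gt (freemod.span (set fs)) = (\<Union>q. ?V q)"
    by blast
  then show ?thesis
    using LT inc by (intro conjI ballI) blast+
qed

end
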